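(* Let $\Omega\subset\mathbb{R}^d$, and let $\mathcal{U},\mathcal{V}$ be Banach spaces with quadratic norms given by covariance operators. Assume that the structural Assumption 1 (see context) holds and that the mean field game $$\mathcal{P}(u^*,m^*,\overline{H}^* )(x)=0\ \ \forall x\in\operatorname{int}\Omega,\qquad \mathcal{B}(u^*,m^* )(x)=0\ \ \forall x\in\partial\Omega,\qquad \int_\Omega u^*dx=0,\ \int_\Omega m^*dx=1$$ has a unique classical solution $(u^*,m^*,\overline{H}^* )$ in the space $\mathcal{U}\times\mathcal{V}\times\mathbb{R}$. Assume further that $\mathcal{U}\subset\subset\mathcal{H}_1\subset\subset C^{t_1}(\Omega)\cap C^{t_1'}(\partial\Omega)$ and $\mathcal{V}\subset\subset\mathcal{H}_2\subset\subset C^{t_2}(\Omega)\cap C^{t_2'}(\partial\Omega)$, where $\mathcal{H}_1$ and $\mathcal{H}_2$ are Banach spaces and $t_1,t_1',t_2,t_2'$ are sufficiently large. Denote by $\{x_i\}_{i=1}^M$ a collection of $M$ sample points, with $x_1,\dots,x_{M_\Omega}\in\operatorname{int}\Omega$ and $x_{M_\Omega+1},\dots,x_M\in\partial\Omega$, and suppose that, as $M\to\infty$, $$\sup_{x\in\operatorname{int}\Omega}\min_{1\le i\le M_\Omega}|x-x_i|\to0\quad\text{and}\quad\sup_{x\in\partial\Omega}\min_{M_\Omega+1\le i\le M}|x-x_i|\to0 .$$ Given $M$ and $\beta>0$, let $(u^\dagger_{M,\beta},m^\dagger_{M,\beta},\overline{H}^\dagger_{M,\beta})$ be a minimizer of $$\|u\|_{\mathcal{U}}^2+\|m\|_{\mathcal{V}}^2+|\overline{H}|^2+\beta\Big|\frac{1}{M_\Omega}\sum_{i=1}^{M_\Omega}u(x_i)\Big|^2+\beta\Big|\frac{1}{M_\Omega}\sum_{i=1}^{M_\Omega}m(x_i)-1\Big|^2$$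 over $(u,m,\overline{H})\in\mathcal{U}\times\mathcal{V}\times\mathbb{R}$ subject to $\mathcal{P}(u,m,\overline{H})(x_i)=0$ for $i=1,\dots,M_\Omega$ and $\mathcal{B}(u,m)(x_j)=0$ for $j=M_\Omega+1,\dots,M$. Then, as $M$ and $\beta$ go to infinity, up to a subsequence (that is, along some sequence $(M_p,\beta_p)$ with $M_p\to\infty$ and $\beta_p\to\infty$), $(u^\dagger_{M,\beta},m^\dagger_{M,\beta},\overline{H}^\dagger_{M,\beta})$ converges to $(u^*,m^*,\overline{H}^* )$ pointwise in $\Omega$ and in $\mathcal{H}_1\times\mathcal{H}_2\times\mathbb{R}$.
   Context: $\mathcal{U}$ is a Banach space with dual $\mathcal{U}^*$ and duality pairing $[\cdot,\cdot]$; there is a covariance operator $\mathcal{K}_{\mathcal{U}}:\mathcal{U}^*\to\mathcal{U}$, linear, bijective, symmetric and positive ($[\mathcal{K}_{\mathcal{U}}\phi,\phi]>0$ for $\phi\neq0$), with $\|u\|_{\mathcal{U}}^2=[\mathcal{K}_{\mathcal{U}}^{-1}u,u]$. The same holds for $\mathcal{V}$. The symbol $\subset\subset$ denotes compact embedding. $\mathcal{P}$ is a nonlinear (possibly vector-valued) differential operator and $\mathcal{B}$ a boundary operator. "Sufficiently large" for $t_1,t_1',t_2,t_2'$ is relative to the operators appearing in $\mathcal{P}$ and $\mathcal{B}$. The sample numbers satisfy $1\le M_\Omega\le M$, with $M_\Omega$ depending on $M$. Assumption 1: for $1\le Q_b\le Q$, $1\le D_b\le D$ there exist bounded linear operators $L_1,\dots,L_{Q_b}\in\mathcal{L}(\mathcal{U};C(\partial\Omega))$,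 $L_{Q_b+1},\dots,L_Q\in\mathcal{L}(\mathcal{U};C(\operatorname{int}\Omega))$, $J_1,\dots,J_{D_b}\in\mathcal{L}(\mathcal{V};C(\partial\Omega))$, $J_{D_b+1},\dots,J_D\in\mathcal{L}(\mathcal{V};C(\operatorname{int}\Omega))$, and continuous nonlinear maps $P$, $B$ such that $\mathcal{P}(u,m,\overline{H})(x)=P(L_{Q_b+1}(u)(x),\dots,L_Q(u)(x),J_{D_b+1}(m)(x),\dots,J_D(m)(x),\overline{H})$ for $x\in\operatorname{int}\Omega$, and $\mathcal{B}(u,m)(x)=B(L_1(u)(x),\dots,L_{Q_b}(u)(x),J_1(m)(x),\dots,J_{D_b}(m)(x))$ for $x\in\partial\Omega$.
   Formalization: Added hypothesis: for all u in U and m in V, the sample means (1/M_Ω)Σu(x_i), (1/M_Ω)Σm(x_i) converge to the integrals over Ω as M→∞; without it the claim fails, e.g. Ω=(0,2), U=V=constants, P=H̄, B=0, where m†→1 but m*=1/2. *)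

theory Defs
  imports "HOL-Analysis.Analysis"
begin

section \<open>Banach spaces with quadratic norms\<close>

text \<open>The dual of \<open>'u\<close> is the space \<open>'u \<Rightarrow>\<^sub>L real\<close>, and the duality pairing \<open>[u, \<phi>]\<close> is
  \<open>blinfun_apply \<phi> u\<close>.\<close>

definition covariance_operator :: "(('u::banach \<Rightarrow>\<^sub>L real) \<Rightarrow> 'u) \<Rightarrow> bool" where
  "covariance_operator K \<longleftrightarrow>
     linear K \<and> bij K \<and>
     (\<forall>\<phi> \<psi>. blinfun_apply \<psi> (K \<phi>) = blinfun_apply \<phi> (K \<psi>)) \<and>
     (\<forall>\<phi>. \<phi> \<noteq> 0 \<longrightarrow> 0 < blinfun_apply \<phi> (K \<phi>))"

definition quadratic_norm :: "(('u::banach \<Rightarrow>\<^sub>L real) \<Rightarrow> 'u) \<Rightarrow> bool" where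
  "quadratic_norm K \<longleftrightarrow>
     covariance_operator K \<and> (\<forall>u. (norm u)\<^sup>2 = blinfun_apply (inv K u) u)"


section \<open>Spaces of continuously differentiable functions\<close>

text \<open>\<open>iter_partial [b\<^sub>1, \<dots>, b\<^sub>n] f\<close> is the iterated partial derivative of \<open>f\<close> along the basis
  vectors \<open>b\<^sub>n, \<dots>, b\<^sub>1\<close>. A list of basis vectors plays the role of a multi-index.\<close>

primrec iter_partial :: "'a::euclidean_space list \<Rightarrow> ('a \<Rightarrow> real) \<Rightarrow> 'a \<Rightarrow> real" where
  "iter_partial [] f = f"
| "iter_partial (b # bs) f = (\<lambda>x. frechet_derivative (iter_partial bs f) (at x) b)"

text \<open>For open \<open>S\<close>: the functions with continuous and bounded partial derivatives up to order \<open>k\<close>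
  on \<open>S\<close>, normed by the supremum of all of them. Boundedness makes this a Banach space.
  (Values outside \<open>S\<close> are irrelevant.)\<close>

definition Ck_space :: "nat \<Rightarrow> 'a::euclidean_space set \<Rightarrow> ('a \<Rightarrow> real) set" where
  "Ck_space k S = {f. \<forall>bs. set bs \<subseteq> Basis \<longrightarrow>
     (length bs \<le> k \<longrightarrow> continuous_on S (iter_partial bs f) \<and> bounded (iter_partial bs f ` S)) \<and>
     (length bs < k \<longrightarrow> iter_partial bs f differentiable_on S)}"

definition Ck_norm :: "nat \<Rightarrow> 'a::euclidean_space set \<Rightarrow> ('a \<Rightarrow> real) \<Rightarrow> real" where
  "Ck_norm k S f = (SUP (bs, x) \<in> {bs. set bs \<subseteq> Basis \<and> length bs \<le> k} \<times> S. \<bar>iter_partial bs f x\<bar>)"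

text \<open>\<open>C\<^sup>k\<close> on a closed set \<open>\<Gamma>\<close> such as \<open>\<partial>\<Omega>\<close>: the restrictions to \<open>\<Gamma>\<close> of \<open>C\<^sup>k\<close> functions on the
  whole space, with the quotient norm. For a compact \<open>C\<^sup>k\<close> hypersurface this is the usual space,
  and for compact \<open>\<Gamma>\<close> and \<open>k = 0\<close> it is \<open>C(\<Gamma>)\<close> with the sup norm.\<close>

definition bdry_Ck_space :: "nat \<Rightarrow> 'a::euclidean_space set \<Rightarrow> ('a \<Rightarrow> real) set" where
  "bdry_Ck_space k \<Gamma> = {g. \<exists>F \<in> Ck_space k UNIV. \<forall>x\<in>\<Gamma>. F x = g x}"

definition bdry_Ck_norm :: "nat \<Rightarrow> 'a::euclidean_space set \<Rightarrow> ('a \<Rightarrow> real) \<Rightarrow> real" where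
  "bdry_Ck_norm k \<Gamma> g = (INF F \<in> {F \<in> Ck_space k UNIV. \<forall>x\<in>\<Gamma>. F x = g x}. Ck_norm k UNIV F)"

text \<open>The Banach space \<open>C\<^sup>t(\<Omega>) \<inter> C\<^bsup>t'\<^esup>(\<partial>\<Omega>)\<close>. Its elements are functions on the closure of \<open>\<Omega>\<close>;
  continuity there says that the values on \<open>\<partial>\<Omega>\<close> are the boundary values of those on \<open>\<Omega>\<close>.\<close>

definition C_inter_space :: "nat \<Rightarrow> nat \<Rightarrow> 'a::euclidean_space set \<Rightarrow> ('a \<Rightarrow> real) set" where
  "C_inter_space t t' \<Omega> =
     {f. continuous_on (closure \<Omega>) f} \<inter> Ck_space t (interior \<Omega>) \<inter> bdry_Ck_space t' (frontier \<Omega>)"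

definition C_inter_norm :: "nat \<Rightarrow> nat \<Rightarrow> 'a::euclidean_space set \<Rightarrow> ('a \<Rightarrow> real) \<Rightarrow> real" where
  "C_inter_norm t t' \<Omega> f = Ck_norm t (interior \<Omega>) f + bdry_Ck_norm t' (frontier \<Omega>) f"


section \<open>Compact embeddings\<close>

definition compact_embedding :: "('x::real_normed_vector \<Rightarrow> 'y::real_normed_vector) \<Rightarrow> bool" where
  "compact_embedding \<iota> \<longleftrightarrow>
     bounded_linear \<iota> \<and> inj \<iota> \<and> (\<forall>B. bounded B \<longrightarrow> compact (closure (\<iota> ` B)))"

text \<open>Compact embedding of a normed space \<open>'h\<close> into \<open>C\<^sup>t(\<Omega>) \<inter> C\<^bsup>t'\<^esup>(\<partial>\<Omega>)\<close>; \<open>E h\<close> is the function on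
  the closure of \<open>\<Omega>\<close> that \<open>h\<close> is identified with. The target is a function space and not a type,
  so that relative compactness of the images of bounded sets is stated through sequences.\<close>

definition compact_embedding_C ::
  "nat \<Rightarrow> nat \<Rightarrow> 'a::euclidean_space set \<Rightarrow> ('h::real_normed_vector \<Rightarrow> 'a \<Rightarrow> real) \<Rightarrow> bool" where
  "compact_embedding_C t t' \<Omega> E \<longleftrightarrow>
     (\<forall>h. E h \<in> C_inter_space t t' \<Omega>) \<and>
     (\<forall>x\<in>closure \<Omega>. linear (\<lambda>h. E h x)) \<and>
     (\<forall>h. (\<forall>x\<in>closure \<Omega>. E h x = 0) \<longrightarrow> h = 0) \<and>
     (\<exists>c. \<forall>h. C_inter_norm t t' \<Omega> (E h) \<le> c * norm h) \<and>
     (\<forall>h :: nat \<Rightarrow> 'h. bounded (range h) \<longrightarrow>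
        (\<exists>f \<in> C_inter_space t t' \<Omega>. \<exists>r. strict_mono r \<and>
           (\<lambda>n. C_inter_norm t t' \<Omega> (\<lambda>x. E (h (r n)) x - f x)) \<longlonglongrightarrow> 0))"


section \<open>The structural assumption\<close>

text \<open>\<open>T \<in> \<L>(\<U>; C(S))\<close>, where \<open>C(S)\<close> carries the sup norm.\<close>

definition bounded_operator_C ::
  "'a::euclidean_space set \<Rightarrow> ('u::real_normed_vector \<Rightarrow> 'a \<Rightarrow> real) \<Rightarrow> bool" where
  "bounded_operator_C S T \<longleftrightarrow>
     (\<forall>x\<in>S. linear (\<lambda>u. T u x)) \<and>
     (\<forall>u. continuous_on S (T u)) \<and>
     (\<exists>c. \<forall>u. \<forall>x\<in>S. \<bar>T u x\<bar> \<le> c * norm u)"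

text \<open>The first \<open>n\<^sub>b\<close> of the \<open>n\<close> operators map into \<open>C(\<partial>\<Omega>)\<close> and the others into \<open>C(int \<Omega>)\<close>.\<close>

definition operator_family ::
  "'a::euclidean_space set \<Rightarrow> nat \<Rightarrow> nat \<Rightarrow> (nat \<Rightarrow> 'u::real_normed_vector \<Rightarrow> 'a \<Rightarrow> real) \<Rightarrow> bool" where
  "operator_family \<Omega> n\<^sub>b n T \<longleftrightarrow>
     1 \<le> n\<^sub>b \<and> n\<^sub>b \<le> n \<and>
     (\<forall>q\<in>{1..n\<^sub>b}. bounded_operator_C (frontier \<Omega>) (T q)) \<and>
     (\<forall>q\<in>{n\<^sub>b+1..n}. bounded_operator_C (interior \<Omega>) (T q))"

text \<open>\<open>t\<close> and \<open>t'\<close> are sufficiently large relative to the operators: each of them is bounded with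
  respect to the norm of \<open>C\<^sup>t(\<Omega>) \<inter> C\<^bsup>t'\<^esup>(\<partial>\<Omega>)\<close>, as a differential operator (with bounded
  coefficients) is when its order does not exceed \<open>t\<close>. Here \<open>E u\<close> is \<open>u\<close> as a function.\<close>

definition sufficiently_large ::
  "nat \<Rightarrow> nat \<Rightarrow> 'a::euclidean_space set \<Rightarrow> ('u \<Rightarrow> 'a \<Rightarrow> real) \<Rightarrow>
   nat \<Rightarrow> nat \<Rightarrow> (nat \<Rightarrow> 'u \<Rightarrow> 'a \<Rightarrow> real) \<Rightarrow> bool" where
  "sufficiently_large t t' \<Omega> E n\<^sub>b n T \<longleftrightarrow>
     (\<forall>q\<in>{1..n\<^sub>b}. \<exists>c. \<forall>u. \<forall>x\<in>frontier \<Omega>. \<bar>T q u x\<bar> \<le> c * C_inter_norm t t' \<Omega> (E u)) \<and>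
     (\<forall>q\<in>{n\<^sub>b+1..n}. \<exists>c. \<forall>u. \<forall>x\<in>interior \<Omega>. \<bar>T q u x\<bar> \<le> c * C_inter_norm t t' \<Omega> (E u))"

text \<open>The tuple \<open>(T\<^sub>q(u)(x))\<close> with \<open>q \<in> I\<close> is the extensional function \<open>\<lambda>q\<in>I. T q u x\<close>, so that
  \<open>\<real>\<^sup>I\<close> is \<open>I \<rightarrow>\<^sub>E UNIV\<close> with the product topology. The index set may be empty.\<close>

definition structural_assumption ::
  "'a::euclidean_space set \<Rightarrow>
   ('u::banach \<Rightarrow> 'v::banach \<Rightarrow> real \<Rightarrow> 'a \<Rightarrow> 'p::euclidean_space) \<Rightarrow>
   ('u \<Rightarrow> 'v \<Rightarrow> 'a \<Rightarrow> 'b::euclidean_space) \<Rightarrow>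
   nat \<Rightarrow> nat \<Rightarrow> (nat \<Rightarrow> 'u \<Rightarrow> 'a \<Rightarrow> real) \<Rightarrow>
   nat \<Rightarrow> nat \<Rightarrow> (nat \<Rightarrow> 'v \<Rightarrow> 'a \<Rightarrow> real) \<Rightarrow>
   ((nat \<Rightarrow> real) \<times> (nat \<Rightarrow> real) \<times> real \<Rightarrow> 'p) \<Rightarrow>
   ((nat \<Rightarrow> real) \<times> (nat \<Rightarrow> real) \<Rightarrow> 'b) \<Rightarrow> bool" where
  "structural_assumption \<Omega> \<P> \<B> Q\<^sub>b Q L D\<^sub>b D J P B \<longleftrightarrow>
     operator_family \<Omega> Q\<^sub>b Q L \<and> operator_family \<Omega> D\<^sub>b D J \<and>
     continuous_on (({Q\<^sub>b+1..Q} \<rightarrow>\<^sub>E UNIV) \<times> ({D\<^sub>b+1..D} \<rightarrow>\<^sub>E UNIV) \<times> UNIV) P \<and>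
     continuous_on (({1..Q\<^sub>b} \<rightarrow>\<^sub>E UNIV) \<times> ({1..D\<^sub>b} \<rightarrow>\<^sub>E UNIV)) B \<and>
     (\<forall>u m H. \<forall>x\<in>interior \<Omega>.
        \<P> u m H x = P (\<lambda>q\<in>{Q\<^sub>b+1..Q}. L q u x, \<lambda>j\<in>{D\<^sub>b+1..D}. J j m x, H)) \<and>
     (\<forall>u m. \<forall>x\<in>frontier \<Omega>.
        \<B> u m x = B (\<lambda>q\<in>{1..Q\<^sub>b}. L q u x, \<lambda>j\<in>{1..D\<^sub>b}. J j m x))"


section \<open>The mean field game and its discretization\<close>

text \<open>\<open>E\<^sub>U u\<close> and \<open>E\<^sub>V m\<close> are the functions on the closure of \<open>\<Omega>\<close> that \<open>u\<close> and \<open>m\<close> stand for.\<close>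

definition mfg_solution ::
  "'a::euclidean_space set \<Rightarrow> ('u \<Rightarrow> 'a \<Rightarrow> real) \<Rightarrow> ('v \<Rightarrow> 'a \<Rightarrow> real) \<Rightarrow>
   ('u \<Rightarrow> 'v \<Rightarrow> real \<Rightarrow> 'a \<Rightarrow> 'p::zero) \<Rightarrow> ('u \<Rightarrow> 'v \<Rightarrow> 'a \<Rightarrow> 'b::zero) \<Rightarrow> 'u \<times> 'v \<times> real \<Rightarrow> bool" where
  "mfg_solution \<Omega> E\<^sub>U E\<^sub>V \<P> \<B> = (\<lambda>(u, m, H).
     (\<forall>x\<in>interior \<Omega>. \<P> u m H x = 0) \<and>
     (\<forall>x\<in>frontier \<Omega>. \<B> u m x = 0) \<and>
     (E\<^sub>U u has_integral 0) \<Omega> \<and> (E\<^sub>V m has_integral 1) \<Omega>)"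

text \<open>\<open>sup\<^sub>y min\<^sub>z |y - z|\<close>, in \<open>[0,\<infinity>]\<close> so that it is infinite for unbounded \<open>S\<close>.\<close>

definition fill_distance :: "'a::metric_space set \<Rightarrow> 'a set \<Rightarrow> ennreal" where
  "fill_distance S X = (SUP y\<in>S. INF z\<in>X. ennreal (dist y z))"

text \<open>The \<open>M\<close>-th collection of sample points is \<open>x M 1, \<dots>, x M M\<close>; its first \<open>M\<^sub>\<Omega> M\<close> points lie
  in the interior.\<close>

definition sample_points ::
  "'a::euclidean_space set \<Rightarrow> (nat \<Rightarrow> nat) \<Rightarrow> (nat \<Rightarrow> nat \<Rightarrow> 'a) \<Rightarrow> bool" where
  "sample_points \<Omega> M\<^sub>\<Omega> x \<longleftrightarrow>
     (\<forall>M\<ge>1. 1 \<le> M\<^sub>\<Omega> M \<and> M\<^sub>\<Omega> M \<le> M \<and>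
        (\<forall>i\<in>{1..M\<^sub>\<Omega> M}. x M i \<in> interior \<Omega>) \<and> (\<forall>i\<in>{M\<^sub>\<Omega> M+1..M}. x M i \<in> frontier \<Omega>)) \<and>
     (\<lambda>M. fill_distance (interior \<Omega>) (x M ` {1..M\<^sub>\<Omega> M})) \<longlonglongrightarrow> 0 \<and>
     (\<lambda>M. fill_distance (frontier \<Omega>) (x M ` {M\<^sub>\<Omega> M+1..M})) \<longlonglongrightarrow> 0"

definition sample_mean :: "(nat \<Rightarrow> nat) \<Rightarrow> (nat \<Rightarrow> nat \<Rightarrow> 'a) \<Rightarrow> nat \<Rightarrow> ('a \<Rightarrow> real) \<Rightarrow> real" where
  "sample_mean M\<^sub>\<Omega> x M f = (1 / real (M\<^sub>\<Omega> M)) * (\<Sum>i=1..M\<^sub>\<Omega> M. f (x M i))"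

text \<open>The sample means are a consistent quadrature rule for \<open>\<integral>\<^sub>\<Omega> f dx\<close>. This does not follow from
  vanishing fill distances, which control neither the distribution of the points nor the volume
  of \<open>\<Omega>\<close>. For points equidistributed in a domain of volume 1 it holds for every bounded
  continuous function.\<close>

definition consistent_quadrature ::
  "'a::euclidean_space set \<Rightarrow> (nat \<Rightarrow> nat) \<Rightarrow> (nat \<Rightarrow> nat \<Rightarrow> 'a) \<Rightarrow> ('a \<Rightarrow> real) \<Rightarrow> bool" where
  "consistent_quadrature \<Omega> M\<^sub>\<Omega> x f \<longleftrightarrow>
     f integrable_on \<Omega> \<and> (\<lambda>M. sample_mean M\<^sub>\<Omega> x M f) \<longlonglongrightarrow> integral \<Omega> f"

definition feasible ::
  "('u \<Rightarrow> 'v \<Rightarrow> real \<Rightarrow> 'a \<Rightarrow> 'p::zero) \<Rightarrow> ('u \<Rightarrow> 'v \<Rightarrow> 'a \<Rightarrow> 'b::zero) \<Rightarrow>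
   (nat \<Rightarrow> nat) \<Rightarrow> (nat \<Rightarrow> nat \<Rightarrow> 'a) \<Rightarrow> nat \<Rightarrow> 'u \<times> 'v \<times> real \<Rightarrow> bool" where
  "feasible \<P> \<B> M\<^sub>\<Omega> x M = (\<lambda>(u, m, H).
     (\<forall>i\<in>{1..M\<^sub>\<Omega> M}. \<P> u m H (x M i) = 0) \<and> (\<forall>j\<in>{M\<^sub>\<Omega> M+1..M}. \<B> u m (x M j) = 0))"

definition penalized_objective ::
  "('u::real_normed_vector \<Rightarrow> 'a \<Rightarrow> real) \<Rightarrow> ('v::real_normed_vector \<Rightarrow> 'a \<Rightarrow> real) \<Rightarrow>
   (nat \<Rightarrow> nat) \<Rightarrow> (nat \<Rightarrow> nat \<Rightarrow> 'a) \<Rightarrow> nat \<Rightarrow> real \<Rightarrow> 'u \<times> 'v \<times> real \<Rightarrow> real" where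
  "penalized_objective E\<^sub>U E\<^sub>V M\<^sub>\<Omega> x M \<beta> = (\<lambda>(u, m, H).
     (norm u)\<^sup>2 + (norm m)\<^sup>2 + \<bar>H\<bar>\<^sup>2 +
     \<beta> * \<bar>sample_mean M\<^sub>\<Omega> x M (E\<^sub>U u)\<bar>\<^sup>2 + \<beta> * \<bar>sample_mean M\<^sub>\<Omega> x M (E\<^sub>V m) - 1\<bar>\<^sup>2)"

end

theory Submission
  imports Defs
begin

text \<open>
  The minimizers are compared with the exact solution, which satisfies every discretized
  constraint. Its penalty terms are \<open>\<beta>\<close> times squared quadrature errors, and these errors vanish as
  \<open>M \<rightarrow> \<infinity>\<close>; so for every \<open>\<beta>\<close> there is an \<open>M\<close> for which the penalty of the exact solution is at
  most \<open>1\<close>. Along a diagonal choice of such pairs with \<open>\<beta>, M \<rightarrow> \<infinity>\<close>, the minimal values stay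
  bounded. This bounds the minimizers in \<open>\<U> \<times> \<V> \<times> \<real>\<close>, and it forces their sample means to
  \<open>0\<close> and \<open>1\<close>, because the squared errors of the means are multiplied by \<open>\<beta> \<rightarrow> \<infinity>\<close>.

  By compactness a subsequence converges in \<open>\<H>\<^sub>1 \<times> \<H>\<^sub>2 \<times> \<real>\<close>. The limit has to lie in
  \<open>\<U> \<times> \<V> \<times> \<real>\<close> again, since uniqueness is only known there. In place of weak compactness
  the proof uses a parallelogram argument (\<open>limit_in_range_of_parallelogram_space\<close>).

  All operators \<open>L\<^sub>q\<close>, \<open>J\<^sub>j\<close> and all point evaluations are controlled by the norms of \<open>\<H>\<^sub>1\<close> and
  \<open>\<H>\<^sub>2\<close> uniformly in the point. Hence the constraints, known at sample points that approach a given
  point, hold at that point in the limit (\<open>constraint_passes_to_limit\<close>), and the sample means of the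
  minimizers have the integrals of the limit as their limits (\<open>sample_mean_passes_to_limit\<close>). The
  limit therefore solves the mean field game, and uniqueness identifies it with the exact solution.
\<close>

section \<open>Quadratic norms and closedness of ranges\<close>

lemma quadratic_norm_parallelogram:
  fixes K :: "('u::banach \<Rightarrow>\<^sub>L real) \<Rightarrow> 'u" and u v :: 'u
  assumes "quadratic_norm K"
  shows "(norm (u + v))\<^sup>2 + (norm (u - v))\<^sup>2 = 2 * (norm u)\<^sup>2 + 2 * (norm v)\<^sup>2"
proof -
  have K: "linear K" "bij K" and norm: "\<And>u. (norm u)\<^sup>2 = blinfun_apply (inv K u) u"
    using assms by (auto simp: quadratic_norm_def covariance_operator_def)
  have inv_K: "linear (inv K)"
    using K
    by (intro linearI inv_f_eq)
      (auto simp: bij_def linear_add linear_scale surj_f_inv_f)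
  show ?thesis
    by (simp add: norm linear_add[OF inv_K] linear_diff[OF inv_K] blinfun.bilinear_simps)
qed

text \<open>
  The parallelogram law makes the space a Hilbert space, whose closed balls have closed images under
  bounded linear maps. The elementary reason: among the points whose image is \<open>1/(n+1)\<close>-close to
  \<open>h\<close>, choose one of almost minimal norm. The bounded sequence \<open>w\<close> keeps these minimal norms
  bounded, so they increase to a finite limit. The sets are convex and decreasing, so midpoints of
  two chosen points compete for the minimum, and the parallelogram law turns this into a Cauchy
  property. The limit of the chosen points is mapped to \<open>h\<close>.
\<close>

lemma limit_in_range_of_parallelogram_space:
  fixes \<iota> :: "'u::banach \<Rightarrow> 'h::real_normed_vector" and w :: "nat \<Rightarrow> 'u"
  assumes parallelogram:
      "\<And>u v::'u. (norm (u + v))\<^sup>2 + (norm (u - v))\<^sup>2 = 2 * (norm u)\<^sup>2 + 2 * (norm v)\<^sup>2"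
    and \<iota>: "bounded_linear \<iota>"
    and w: "bounded (range w)" and lim: "(\<lambda>n. \<iota> (w n)) \<longlonglongrightarrow> h"
  shows "\<exists>v. \<iota> v = h"
proof -
  interpret bounded_linear \<iota> by (rule \<iota>)
  obtain R where R: "\<And>n. norm (w n) \<le> R"
    using w by (auto simp: bounded_iff)
  define \<epsilon> where "\<epsilon> n = 1 / real (Suc n)" for n
  have \<epsilon>_pos: "\<epsilon> n > 0" for n
    by (simp add: \<epsilon>_def)
  have \<epsilon>_lim: "\<epsilon> \<longlonglongrightarrow> 0"
    unfolding \<epsilon>_def by (rule LIMSEQ_Suc[OF lim_1_over_n])
  define A where "A n = {u. norm (\<iota> u - h) \<le> \<epsilon> n}" for n
  define d where "d n = Inf ((\<lambda>u. (norm u)\<^sup>2) ` A n)" for n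
  have bdd: "bdd_below ((\<lambda>u. (norm u)\<^sup>2) ` A n)" for n
    by (rule bdd_belowI[of _ 0]) auto
  have A_mono: "A m \<subseteq> A n" if "n \<le> m" for n m
  proof -
    have "\<epsilon> m \<le> \<epsilon> n"
      using that by (simp add: \<epsilon>_def frac_le)
    then show ?thesis
      by (auto simp: A_def)
  qed
  have w_in: "\<exists>k. w k \<in> A n" for n
  proof -
    have "\<forall>\<^sub>F k in sequentially. dist (\<iota> (w k)) h < \<epsilon> n"
      using tendstoD[OF lim \<epsilon>_pos] .
    then obtain k where "dist (\<iota> (w k)) h < \<epsilon> n"
      by (auto simp: eventually_sequentially)
    then show ?thesis
      by (intro exI[of _ k]) (simp add: A_def dist_norm)
  qed
  have d_le: "d n \<le> (norm u)\<^sup>2" if "u \<in> A n" for n u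
    unfolding d_def using that by (intro cInf_lower bdd) auto
  have d_bound: "d n \<le> R\<^sup>2" for n
  proof -
    obtain k where "w k \<in> A n" using w_in by blast
    then have "d n \<le> (norm (w k))\<^sup>2" by (rule d_le)
    also have "\<dots> \<le> R\<^sup>2" using R by (intro power_mono) auto
    finally show ?thesis .
  qed
  have d_incseq: "incseq d"
  proof (rule incseq_SucI)
    fix n show "d n \<le> d (Suc n)"
      unfolding d_def using w_in[of "Suc n"] A_mono[of n "Suc n"]
      by (intro cInf_superset_mono bdd) auto
  qed
  obtain d' where d_lim: "d \<longlonglongrightarrow> d'"
    using incseq_convergent[OF d_incseq, of "R\<^sup>2"] d_bound by blast
  have "\<exists>u. u \<in> A n \<and> (norm u)\<^sup>2 < d n + \<epsilon> n" for n
  proof -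
    have "(\<lambda>u. (norm u)\<^sup>2) ` A n \<noteq> {}" using w_in by auto
    then have "\<exists>a\<in>(\<lambda>u. (norm u)\<^sup>2) ` A n. a < d n + \<epsilon> n"
      unfolding d_def using \<epsilon>_pos[of n] by (intro cInf_lessD) auto
    then show ?thesis by auto
  qed
  then obtain v where v_in: "\<And>n. v n \<in> A n" and v_norm: "\<And>n. (norm (v n))\<^sup>2 < d n + \<epsilon> n"
    by metis
  have dist_v: "(norm (v n - v m))\<^sup>2 \<le> 2 * (d' - d n) + 4 * \<epsilon> n" if "n \<le> m" for n m
  proof -
    have vm: "v m \<in> A n" using v_in A_mono[OF that] by blast
    have "\<iota> ((1/2) *\<^sub>R (v n + v m)) - h = (1/2) *\<^sub>R ((\<iota> (v n) - h) + (\<iota> (v m) - h))"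
    proof -
      have "h = (1/2) *\<^sub>R h + (1/2) *\<^sub>R h" by (simp flip: scaleR_add_left)
      then show ?thesis by (simp add: scaleR add algebra_simps)
    qed
    also have "norm \<dots> \<le> (1/2) * (norm (\<iota> (v n) - h) + norm (\<iota> (v m) - h))"
      using norm_triangle_ineq[of "\<iota> (v n) - h" "\<iota> (v m) - h"] by simp
    also have "\<dots> \<le> \<epsilon> n" using vm v_in[of n] by (simp add: A_def)
    finally have "(1/2) *\<^sub>R (v n + v m) \<in> A n" by (simp add: A_def)
    from d_le[OF this] have mid: "4 * d n \<le> (norm (v n + v m))\<^sup>2"
      by (simp add: power_divide)
    have "d m \<le> d'" using incseq_le[OF d_incseq d_lim] .
    moreover have "\<epsilon> m \<le> \<epsilon> n" using that by (simp add: \<epsilon>_def frac_le)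
    ultimately show ?thesis
      using parallelogram[of "v n" "v m"] mid v_norm[of n] v_norm[of m] by (smt (verit))
  qed
  have "(\<lambda>n. 2 * (d' - d n) + 4 * \<epsilon> n) \<longlonglongrightarrow> 2 * (d' - d') + 4 * 0"
    by (intro tendsto_intros d_lim \<epsilon>_lim)
  then have rhs_lim: "(\<lambda>n. 2 * (d' - d n) + 4 * \<epsilon> n) \<longlonglongrightarrow> 0"
    by simp
  have "Cauchy v"
  proof (rule metric_CauchyI)
    fix e :: real assume e: "e > 0"
    have "\<forall>\<^sub>F n in sequentially. 2 * (d' - d n) + 4 * \<epsilon> n < (e/2)\<^sup>2"
      using e by (intro order_tendstoD(2)[OF rhs_lim]) auto
    then obtain N where N: "2 * (d' - d N) + 4 * \<epsilon> N < (e/2)\<^sup>2"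
      by (auto simp: eventually_sequentially)
    have close: "norm (v N - v m) < e/2" if "N \<le> m" for m
      using dist_v[OF that] N e by (intro power2_less_imp_less[of _ "e/2"]) auto
    have "dist (v m) (v n) < e" if "m \<ge> N" "n \<ge> N" for m n
      using close[OF that(1)] close[OF that(2)] dist_triangle_half_r[of "v N" "v m" e "v n"]
      by (simp add: dist_norm)
    then show "\<exists>M. \<forall>m\<ge>M. \<forall>n\<ge>M. dist (v m) (v n) < e" by blast
  qed
  then obtain v' where "v \<longlonglongrightarrow> v'"
    by (auto simp: Cauchy_convergent_iff convergent_def)
  then have "(\<lambda>n. \<iota> (v n)) \<longlonglongrightarrow> \<iota> v'"
    by (rule tendsto)
  moreover have "(\<lambda>n. \<iota> (v n)) \<longlonglongrightarrow> h"
  proof (rule LIM_zero_cancel, rule Lim_null_comparison[OF _ \<epsilon>_lim])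
    show "\<forall>\<^sub>F n in sequentially. norm (\<iota> (v n) - h) \<le> \<epsilon> n"
      using v_in by (auto simp: A_def)
  qed
  ultimately show ?thesis
    using LIMSEQ_unique by blast
qed

lemma compact_embedding_convergent_subsequence:
  fixes K :: "('u::banach \<Rightarrow>\<^sub>L real) \<Rightarrow> 'u" and \<iota> :: "'u \<Rightarrow> 'h::real_normed_vector"
    and w :: "nat \<Rightarrow> 'u"
  assumes "quadratic_norm K" and \<iota>: "compact_embedding \<iota>" and w: "bounded (range w)"
  obtains r v where "strict_mono r" "(\<lambda>n. \<iota> (w (r n))) \<longlonglongrightarrow> \<iota> v"
proof -
  have "seq_compact (closure (\<iota> ` range w))"
    using \<iota> w by (auto simp: compact_embedding_def compact_eq_seq_compact_metric)
  moreover have "\<forall>n. \<iota> (w n) \<in> closure (\<iota> ` range w)"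
    by (intro allI subsetD[OF closure_subset]) simp
  ultimately obtain h r where "h \<in> closure (\<iota> ` range w)" and r: "strict_mono r"
    and lim: "((\<lambda>n. \<iota> (w n)) \<circ> r) \<longlonglongrightarrow> h"
    by (rule seq_compactE)
  have "bounded (range (w \<circ> r))"
    using w by (rule bounded_subset) auto
  then obtain v where "\<iota> v = h"
    using limit_in_range_of_parallelogram_space[OF quadratic_norm_parallelogram[OF assms(1)],
        of \<iota> "w \<circ> r" h] \<iota> lim
    by (force simp: compact_embedding_def comp_def)
  with r lim that[of r v] show thesis
    by (simp add: o_def)
qed


section \<open>Uniform control by the norm of the intermediate space\<close>

lemma Ck_norm_upper:
  fixes f :: "'a::euclidean_space \<Rightarrow> real"
  assumes f: "f \<in> Ck_space k S" and y: "y \<in> S"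
  shows "\<bar>f y\<bar> \<le> Ck_norm k S f"
proof -
  define I where "I = {bs :: 'a list. set bs \<subseteq> Basis \<and> length bs \<le> k}"
  have fin: "finite I"
    unfolding I_def by (rule finite_lists_length_le) simp
  have "\<exists>c. \<forall>x\<in>S. \<bar>iter_partial bs f x\<bar> \<le> c" if "bs \<in> I" for bs
    using f that by (auto simp: I_def Ck_space_def bounded_iff)
  then obtain c where c: "\<And>bs x. bs \<in> I \<Longrightarrow> x \<in> S \<Longrightarrow> \<bar>iter_partial bs f x\<bar> \<le> c bs"
    by metis
  have "\<bar>iter_partial bs f x\<bar> \<le> Max (c ` I)" if "bs \<in> I" "x \<in> S" for bs x
    using c[OF that] by (rule order_trans) (use fin that(1) in auto)
  then have "bdd_above ((\<lambda>(bs, x). \<bar>iter_partial bs f x\<bar>) ` (I \<times> S))"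
    by (intro bdd_aboveI[of _ "Max (c ` I)"]) auto
  moreover have "([], y) \<in> I \<times> S"
    using y by (simp add: I_def)
  ultimately have "(\<lambda>(bs, x). \<bar>iter_partial bs f x\<bar>) ([], y) \<le> Ck_norm k S f"
    unfolding Ck_norm_def I_def[symmetric] by (intro cSUP_upper)
  then show ?thesis by simp
qed

lemma bdry_Ck_norm_nonneg:
  assumes "g \<in> bdry_Ck_space k \<Gamma>"
  shows "0 \<le> bdry_Ck_norm k \<Gamma> g"
  unfolding bdry_Ck_norm_def
proof (rule cINF_greatest)
  fix F assume "F \<in> {F \<in> Ck_space k UNIV. \<forall>x\<in>\<Gamma>. F x = g x}"
  then have "\<bar>F 0\<bar> \<le> Ck_norm k UNIV F" by (intro Ck_norm_upper) auto
  then show "0 \<le> Ck_norm k UNIV F" by simp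
qed (use assms in \<open>auto simp: bdry_Ck_space_def\<close>)

lemma bdry_Ck_norm_upper:
  assumes "g \<in> bdry_Ck_space k \<Gamma>" "y \<in> \<Gamma>"
  shows "\<bar>g y\<bar> \<le> bdry_Ck_norm k \<Gamma> g"
  unfolding bdry_Ck_norm_def
proof (rule cINF_greatest)
  fix F assume "F \<in> {F \<in> Ck_space k UNIV. \<forall>x\<in>\<Gamma>. F x = g x}"
  then show "\<bar>g y\<bar> \<le> Ck_norm k UNIV F"
    using Ck_norm_upper[of F k UNIV y] assms(2) by auto
qed (use assms in \<open>auto simp: bdry_Ck_space_def\<close>)

text \<open>
  The interior has to be nonempty because the supremum defining its norm is an unspecified
  real number for the empty set.
\<close>

lemma C_inter_norm_upper:
  assumes f: "f \<in> C_inter_space t t' \<Omega>" and ne: "interior \<Omega> \<noteq> {}" and y: "y \<in> closure \<Omega>"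
  shows "\<bar>f y\<bar> \<le> C_inter_norm t t' \<Omega> f"
proof -
  have i: "f \<in> Ck_space t (interior \<Omega>)" and b: "f \<in> bdry_Ck_space t' (frontier \<Omega>)"
    using f by (auto simp: C_inter_space_def)
  obtain z where "z \<in> interior \<Omega>" using ne by blast
  from Ck_norm_upper[OF i this] have "0 \<le> Ck_norm t (interior \<Omega>) f" by simp
  moreover have "0 \<le> bdry_Ck_norm t' (frontier \<Omega>) f" by (rule bdry_Ck_norm_nonneg[OF b])
  moreover have "y \<in> interior \<Omega> \<or> y \<in> frontier \<Omega>"
    using y by (auto simp: frontier_def)
  ultimately show ?thesis
    using Ck_norm_upper[OF i, of y] bdry_Ck_norm_upper[OF b, of y]
    by (auto simp: C_inter_norm_def)
qed

lemma compact_embedding_C_uniform_bound: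
  assumes E: "compact_embedding_C t t' \<Omega> E" and ne: "interior \<Omega> \<noteq> {}"
  obtains c where "\<And>h. C_inter_norm t t' \<Omega> (E h) \<le> c * norm h"
    "\<And>h y. y \<in> closure \<Omega> \<Longrightarrow> \<bar>E h y\<bar> \<le> c * norm h"
proof -
  obtain c where c: "\<And>h. C_inter_norm t t' \<Omega> (E h) \<le> c * norm h"
    using E by (auto simp: compact_embedding_C_def)
  have "\<bar>E h y\<bar> \<le> c * norm h" if "y \<in> closure \<Omega>" for h y
    using C_inter_norm_upper[OF _ ne that, of "E h" t t'] c[of h] E
    by (auto simp: compact_embedding_C_def)
  with c that show thesis by blast
qed

lemma compact_embedding_C_evaluation:
  assumes E: "compact_embedding_C t t' \<Omega> E" and ne: "interior \<Omega> \<noteq> {}" and y: "y \<in> closure \<Omega>"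
  shows "bounded_linear (\<lambda>h. E h y)"
proof -
  obtain c where "\<And>h. \<bar>E h y\<bar> \<le> c * norm h"
    using compact_embedding_C_uniform_bound[OF E ne] y by metis
  moreover have "linear (\<lambda>h. E h y)"
    using E y by (simp add: compact_embedding_C_def)
  ultimately show ?thesis
    by (intro bounded_linear.intro bounded_linear_axioms.intro exI[of _ c]) (auto simp: mult.commute)
qed

text \<open>
  An operator bounded by the norm of \<open>C\<^sup>t(\<Omega>) \<inter> C\<^bsup>t'\<^esup>(\<partial>\<Omega>)\<close> is bounded by the weaker norm that
  \<open>\<U>\<close> inherits from the intermediate space. This is where the smoothness indices have to be
  sufficiently large.
\<close>

lemma operator_bound_intermediate_norm:
  fixes T :: "'u \<Rightarrow> 'a::euclidean_space \<Rightarrow> real"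
  assumes E: "compact_embedding_C t t' \<Omega> E" and ne: "interior \<Omega> \<noteq> {}"
    and T: "\<exists>c. \<forall>u. \<forall>x\<in>S. \<bar>T u x\<bar> \<le> c * C_inter_norm t t' \<Omega> ((E \<circ> \<iota>) u)"
  shows "\<exists>c. \<forall>u. \<forall>x\<in>S. \<bar>T u x\<bar> \<le> c * norm (\<iota> u)"
proof -
  obtain c\<^sub>E where c\<^sub>E: "\<And>h. C_inter_norm t t' \<Omega> (E h) \<le> c\<^sub>E * norm h"
    using compact_embedding_C_uniform_bound[OF E ne] by metis
  obtain c where c: "\<And>u x. x \<in> S \<Longrightarrow> \<bar>T u x\<bar> \<le> c * C_inter_norm t t' \<Omega> (E (\<iota> u))"
    using T by auto
  have nonneg: "0 \<le> C_inter_norm t t' \<Omega> (E h)" for h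
  proof -
    obtain y where "y \<in> closure \<Omega>"
      using ne interior_subset closure_subset by blast
    then have "\<bar>E h y\<bar> \<le> C_inter_norm t t' \<Omega> (E h)"
      using E ne by (intro C_inter_norm_upper) (auto simp: compact_embedding_C_def)
    then show ?thesis by simp
  qed
  have "\<bar>T u x\<bar> \<le> (\<bar>c\<bar> * c\<^sub>E) * norm (\<iota> u)" if "x \<in> S" for u x
  proof -
    have "\<bar>T u x\<bar> \<le> \<bar>c\<bar> * C_inter_norm t t' \<Omega> (E (\<iota> u))"
      using c[OF that, of u] mult_right_mono[OF abs_ge_self nonneg] by (rule order_trans)
    also have "\<dots> \<le> \<bar>c\<bar> * (c\<^sub>E * norm (\<iota> u))"
      by (intro mult_left_mono c\<^sub>E) auto
    finally show ?thesis by (simp add: mult.assoc)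
  qed
  then show ?thesis by blast
qed


section \<open>Passing to the limit in the constraints\<close>

text \<open>
  Convergence in the intermediate norm gives uniform convergence of the functions \<open>T (w n)\<close>, which
  is what allows the evaluation point to move with \<open>n\<close>.
\<close>

lemma operator_converges_at_moving_points:
  fixes T :: "'u::real_normed_vector \<Rightarrow> 'a::euclidean_space \<Rightarrow> real"
    and \<iota> :: "'u \<Rightarrow> 'h::real_normed_vector"
  assumes T: "bounded_operator_C S T" and \<iota>: "bounded_linear \<iota>"
    and bound: "\<exists>c. \<forall>u. \<forall>x\<in>S. \<bar>T u x\<bar> \<le> c * norm (\<iota> u)"
    and w: "(\<lambda>n. \<iota> (w n)) \<longlonglongrightarrow> \<iota> v"
    and z: "z \<longlonglongrightarrow> y" "\<forall>\<^sub>F n in sequentially. z n \<in> S" "y \<in> S"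
  shows "(\<lambda>n. T (w n) (z n)) \<longlonglongrightarrow> T v y"
proof -
  obtain c where c: "\<And>u x. x \<in> S \<Longrightarrow> \<bar>T u x\<bar> \<le> c * norm (\<iota> u)"
    using bound by blast
  have "(\<lambda>n. T (w n) (z n) - T v (z n)) \<longlonglongrightarrow> 0"
  proof (rule Lim_null_comparison)
    show "\<forall>\<^sub>F n in sequentially. norm (T (w n) (z n) - T v (z n)) \<le> c * norm (\<iota> (w n) - \<iota> v)"
      using z(2)
    proof eventually_elim
      case (elim n)
      then have "linear (\<lambda>u. T u (z n))"
        using T by (simp add: bounded_operator_C_def)
      from linear_diff[OF this] have "T (w n) (z n) - T v (z n) = T (w n - v) (z n)"
        by simp
      then show ?case
        using c[OF elim, of "w n - v"] by (simp add: linear_diff[OF bounded_linear.linear[OF \<iota>]])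
    qed
    show "(\<lambda>n. c * norm (\<iota> (w n) - \<iota> v)) \<longlonglongrightarrow> 0"
      using tendsto_mult_right_zero[OF tendsto_norm_zero[OF LIM_zero[OF w]]] .
  qed
  moreover have "(\<lambda>n. T v (z n)) \<longlonglongrightarrow> T v y"
    using T z by (intro continuous_on_tendsto_compose[of S "T v"]) (auto simp: bounded_operator_C_def)
  ultimately show ?thesis
    using tendsto_add by fastforce
qed

text \<open>
  Where the sample set is empty its fill distance from a nonempty set is infinite, so this
  happens only finitely often and the arbitrary point chosen then is harmless.
\<close>

lemma fill_distance_approximating_points:
  fixes X :: "nat \<Rightarrow> 'a::metric_space set"
  assumes fill: "(\<lambda>n. fill_distance S (X n)) \<longlonglongrightarrow> 0" and y: "y \<in> S"
  obtains z where "\<forall>\<^sub>F n in sequentially. z n \<in> X n" "z \<longlonglongrightarrow> y"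
proof -
  \<comment> \<open>The slack \<open>1 / Suc n\<close> is there because the infimum of the distances need not be attained.\<close>
  have "\<exists>z. \<forall>e>0. fill_distance S (X n) < ennreal e \<longrightarrow> z \<in> X n \<and> dist y z < e + 1 / Suc n" for n
  proof (cases "fill_distance S (X n)")
    case (real r)
    have "(INF z\<in>X n. ennreal (dist y z)) \<le> fill_distance S (X n)"
      unfolding fill_distance_def using y by (rule SUP_upper)
    also have "\<dots> < ennreal (r + 1 / Suc n)"
      using real by (simp add: ennreal_less_iff)
    finally obtain z where z: "z \<in> X n" "ennreal (dist y z) < ennreal (r + 1 / Suc n)"
      by (auto simp: INF_less_iff)
    then have "dist y z < r + 1 / Suc n"
      by (simp add: ennreal_less_iff)
    with z(1) real show ?thesis
      by (intro exI[of _ z]) (auto simp: ennreal_less_iff)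
  qed (simp add: top_unique)
  then obtain z where z: "\<And>n e. e > 0 \<Longrightarrow> fill_distance S (X n) < ennreal e \<Longrightarrow>
      z n \<in> X n \<and> dist y (z n) < e + 1 / Suc n"
    by metis
  have small: "\<forall>\<^sub>F n in sequentially. fill_distance S (X n) < ennreal e" if "e > 0" for e
    using that by (intro order_tendstoD(2)[OF fill]) simp
  show thesis
  proof
    show "\<forall>\<^sub>F n in sequentially. z n \<in> X n"
      using small[OF zero_less_one] by eventually_elim (use z[of 1] in auto)
    show "z \<longlonglongrightarrow> y"
    proof (rule tendstoI)
      fix e :: real assume e: "e > 0"
      have "\<forall>\<^sub>F n in sequentially. 1 / real (Suc n) < e / 2"
        using e by (intro order_tendstoD(2)[OF LIMSEQ_Suc[OF lim_1_over_n]]) simp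
      with small[OF half_gt_zero[OF e]] show "\<forall>\<^sub>F n in sequentially. dist (z n) y < e"
      proof eventually_elim
        case (elim n)
        then show ?case using z[of "e/2" n] e by (simp add: dist_commute)
      qed
    qed
  qed
qed

lemma tendsto_restrict_coordinatewise:
  fixes f :: "nat \<Rightarrow> 'i \<Rightarrow> real"
  assumes "\<And>i. i \<in> I \<Longrightarrow> (\<lambda>n. f n i) \<longlonglongrightarrow> l i"
  shows "(\<lambda>n. restrict (f n) I) \<longlonglongrightarrow> restrict l I"
proof -
  have "limitin (product_topology (\<lambda>_. euclidean) UNIV) (\<lambda>n. restrict (f n) I) (restrict l I) sequentially"
    using assms by (auto simp: limitin_componentwise restrict_def)
  then show ?thesis
    unfolding euclidean_product_topology by simp
qed

text \<open>
  Evaluate the \<open>n\<close>-th constraint at sample points that approach \<open>y\<close>. All coordinates of the two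
  tuples converge there, which is convergence in the product topology, so \<open>G\<close> can follow.
\<close>

lemma constraint_passes_to_limit:
  fixes L :: "'i \<Rightarrow> 'u::real_normed_vector \<Rightarrow> 'a::euclidean_space \<Rightarrow> real"
    and J :: "'j \<Rightarrow> 'v::real_normed_vector \<Rightarrow> 'a \<Rightarrow> real"
    and \<iota>\<^sub>1 :: "'u \<Rightarrow> 'h1::real_normed_vector" and \<iota>\<^sub>2 :: "'v \<Rightarrow> 'h2::real_normed_vector"
    and G :: "('i \<Rightarrow> real) \<times> ('j \<Rightarrow> real) \<times> real \<Rightarrow> 'p::real_normed_vector"
  assumes \<iota>: "bounded_linear \<iota>\<^sub>1" "bounded_linear \<iota>\<^sub>2"
    and L: "\<And>q. q \<in> I \<Longrightarrow> bounded_operator_C S (L q)"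
      "\<And>q. q \<in> I \<Longrightarrow> \<exists>c. \<forall>u. \<forall>x\<in>S. \<bar>L q u x\<bar> \<le> c * norm (\<iota>\<^sub>1 u)"
    and J: "\<And>j. j \<in> I' \<Longrightarrow> bounded_operator_C S (J j)"
      "\<And>j. j \<in> I' \<Longrightarrow> \<exists>c. \<forall>m. \<forall>x\<in>S. \<bar>J j m x\<bar> \<le> c * norm (\<iota>\<^sub>2 m)"
    and G: "continuous_on ((I \<rightarrow>\<^sub>E UNIV) \<times> (I' \<rightarrow>\<^sub>E UNIV) \<times> UNIV) G"
    and conv: "(\<lambda>n. \<iota>\<^sub>1 (u n)) \<longlonglongrightarrow> \<iota>\<^sub>1 u'" "(\<lambda>n. \<iota>\<^sub>2 (m n)) \<longlonglongrightarrow> \<iota>\<^sub>2 m'" "H \<longlonglongrightarrow> H'"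
    and fill: "(\<lambda>n. fill_distance S (X n)) \<longlonglongrightarrow> 0" and X: "\<And>n. X n \<subseteq> S"
    and zero: "\<And>n z. z \<in> X n \<Longrightarrow> G (\<lambda>q\<in>I. L q (u n) z, \<lambda>j\<in>I'. J j (m n) z, H n) = 0"
    and y: "y \<in> S"
  shows "G (\<lambda>q\<in>I. L q u' y, \<lambda>j\<in>I'. J j m' y, H') = 0"
proof -
  obtain z where z: "\<forall>\<^sub>F n in sequentially. z n \<in> X n" "z \<longlonglongrightarrow> y"
    using fill_distance_approximating_points[OF fill y] .
  have z_S: "\<forall>\<^sub>F n in sequentially. z n \<in> S"
    using z(1) by eventually_elim (use X in blast)
  have "(\<lambda>n. G (\<lambda>q\<in>I. L q (u n) (z n), \<lambda>j\<in>I'. J j (m n) (z n), H n)) \<longlonglongrightarrow>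
      G (\<lambda>q\<in>I. L q u' y, \<lambda>j\<in>I'. J j m' y, H')"
  proof (rule continuous_on_tendsto_compose[OF G])
    show "(\<lambda>n. (\<lambda>q\<in>I. L q (u n) (z n), \<lambda>j\<in>I'. J j (m n) (z n), H n)) \<longlonglongrightarrow>
        (\<lambda>q\<in>I. L q u' y, \<lambda>j\<in>I'. J j m' y, H')"
      by (intro tendsto_Pair tendsto_restrict_coordinatewise conv(3)
          operator_converges_at_moving_points[OF L(1) \<iota>(1) L(2) conv(1) z(2) z_S y]
          operator_converges_at_moving_points[OF J(1) \<iota>(2) J(2) conv(2) z(2) z_S y])
  qed auto
  moreover have "\<forall>\<^sub>F n in sequentially.
      G (\<lambda>q\<in>I. L q (u n) (z n), \<lambda>j\<in>I'. J j (m n) (z n), H n) = 0"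
    using z(1) by eventually_elim (rule zero)
  ultimately have "(\<lambda>n. 0) \<longlonglongrightarrow> G (\<lambda>q\<in>I. L q u' y, \<lambda>j\<in>I'. J j m' y, H')"
    by (rule Lim_transform_eventually)
  then show ?thesis
    by (simp add: LIMSEQ_const_iff)
qed


section \<open>Passing to the limit in the sample means\<close>

lemma sample_mean_diff_le:
  assumes "1 \<le> M\<^sub>\<Omega> M" and "\<And>i. i \<in> {1..M\<^sub>\<Omega> M} \<Longrightarrow> \<bar>f (x M i) - g (x M i)\<bar> \<le> e"
  shows "\<bar>sample_mean M\<^sub>\<Omega> x M f - sample_mean M\<^sub>\<Omega> x M g\<bar> \<le> e"
proof -
  have "\<bar>\<Sum>i=1..M\<^sub>\<Omega> M. f (x M i) - g (x M i)\<bar> \<le> (\<Sum>i=1..M\<^sub>\<Omega> M. \<bar>f (x M i) - g (x M i)\<bar>)"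
    by (rule sum_abs)
  also have "\<dots> \<le> real (M\<^sub>\<Omega> M) * e"
    using sum_bounded_above[of "{1..M\<^sub>\<Omega> M}" "\<lambda>i. \<bar>f (x M i) - g (x M i)\<bar>" e] assms(2) by simp
  finally have "\<bar>\<Sum>i=1..M\<^sub>\<Omega> M. f (x M i) - g (x M i)\<bar> / real (M\<^sub>\<Omega> M) \<le> e"
    using assms(1) by (simp add: divide_simps mult.commute)
  then show ?thesis
    by (simp add: sample_mean_def sum_subtractf flip: diff_divide_distrib)
qed

text \<open>
  Uniform closeness of the functions makes their sample means close, whatever the sample points are;
  so the quadrature rule only has to be consistent for the fixed limit function.
\<close>

lemma sample_mean_passes_to_limit:
  fixes h :: "nat \<Rightarrow> 'h::real_normed_vector"
  assumes E: "compact_embedding_C t t' \<Omega> E" and samples: "sample_points \<Omega> M\<^sub>\<Omega> x"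
    and quadrature: "consistent_quadrature \<Omega> M\<^sub>\<Omega> x (E h')"
    and M: "\<And>n. 1 \<le> M n" "filterlim M at_top sequentially"
    and h: "h \<longlonglongrightarrow> h'"
    and mean: "(\<lambda>n. sample_mean M\<^sub>\<Omega> x (M n) (E (h n))) \<longlonglongrightarrow> a"
  shows "(E h' has_integral a) \<Omega>"
proof -
  have pts: "1 \<le> M\<^sub>\<Omega> (M n)" "\<And>i. i \<in> {1..M\<^sub>\<Omega> (M n)} \<Longrightarrow> x (M n) i \<in> interior \<Omega>" for n
    using samples M(1)[of n] by (auto simp: sample_points_def)
  have ne: "interior \<Omega> \<noteq> {}"
    using pts(1)[of 0] pts(2)[of 1 0] by auto
  have in_closure: "y \<in> closure \<Omega>" if "y \<in> interior \<Omega>" for y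
    using that interior_subset closure_subset by blast
  obtain c where c: "\<And>h y. y \<in> closure \<Omega> \<Longrightarrow> \<bar>E h y\<bar> \<le> c * norm h"
    using compact_embedding_C_uniform_bound[OF E ne] by metis
  have diff: "\<bar>E (h n) y - E h' y\<bar> \<le> c * norm (h n - h')" if "y \<in> closure \<Omega>" for n y
  proof -
    have "linear (\<lambda>h. E h y)"
      using E that by (simp add: compact_embedding_C_def)
    from linear_diff[OF this] show ?thesis
      using c[OF that, of "h n - h'"] by simp
  qed
  have "(\<lambda>n. sample_mean M\<^sub>\<Omega> x (M n) (E (h n)) - sample_mean M\<^sub>\<Omega> x (M n) (E h')) \<longlonglongrightarrow> 0"
  proof (rule Lim_null_comparison)
    show "\<forall>\<^sub>F n in sequentially. norm (sample_mean M\<^sub>\<Omega> x (M n) (E (h n)) -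
        sample_mean M\<^sub>\<Omega> x (M n) (E h')) \<le> c * norm (h n - h')"
    proof (intro always_eventually allI)
      fix n
      show "norm (sample_mean M\<^sub>\<Omega> x (M n) (E (h n)) - sample_mean M\<^sub>\<Omega> x (M n) (E h'))
          \<le> c * norm (h n - h')"
        unfolding real_norm_def
        by (rule sample_mean_diff_le) (use pts in \<open>auto intro!: diff in_closure\<close>)
    qed
    show "(\<lambda>n. c * norm (h n - h')) \<longlonglongrightarrow> 0"
      using tendsto_mult_right_zero[OF tendsto_norm_zero[OF LIM_zero[OF h]]] .
  qed
  from tendsto_diff[OF mean this] have "(\<lambda>n. sample_mean M\<^sub>\<Omega> x (M n) (E h')) \<longlonglongrightarrow> a"
    by simp
  moreover have "(\<lambda>n. sample_mean M\<^sub>\<Omega> x (M n) (E h')) \<longlonglongrightarrow> integral \<Omega> (E h')"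
    using quadrature by (intro filterlim_compose[OF _ M(2)]) (simp add: consistent_quadrature_def)
  ultimately have "integral \<Omega> (E h') = a"
    by (rule LIMSEQ_unique[symmetric])
  then show ?thesis
    using quadrature by (auto simp: consistent_quadrature_def has_integral_iff)
qed

lemma bounded_penalty_imp_tendsto_zero:
  fixes a \<beta> :: "nat \<Rightarrow> real"
  assumes "\<And>n. 0 < \<beta> n" and \<beta>: "filterlim \<beta> at_top sequentially"
    and bound: "\<And>n. \<beta> n * \<bar>a n\<bar>\<^sup>2 \<le> C"
  shows "a \<longlonglongrightarrow> 0"
proof -
  have "(\<lambda>n. (a n)\<^sup>2) \<longlonglongrightarrow> 0"
  proof (rule Lim_null_comparison)
    have "(a n)\<^sup>2 \<le> C / \<beta> n" for n
      using bound[of n] assms(1)[of n] by (simp add: field_simps)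
    then show "\<forall>\<^sub>F n in sequentially. norm ((a n)\<^sup>2) \<le> C / \<beta> n"
      by simp
    show "(\<lambda>n. C / \<beta> n) \<longlonglongrightarrow> 0"
      using tendsto_divide_0[OF tendsto_const filterlim_at_top_imp_at_infinity[OF \<beta>]] .
  qed
  from tendsto_real_sqrt[OF this] show ?thesis
    by (simp add: tendsto_rabs_zero_iff)
qed


section \<open>Convergence of the minimizers\<close>

text \<open>
  In the application \<open>e\<close> is the squared quadrature error of the exact solution. A large \<open>\<beta>\<close> may
  amplify it without bound for a fixed \<open>M\<close>; so each \<open>\<beta>\<close> gets its own, sufficiently large \<open>M\<close>.
\<close>

lemma diagonal_penalty_choice:
  fixes e :: "nat \<Rightarrow> real"
  assumes "e \<longlonglongrightarrow> 0"
  obtains M :: "nat \<Rightarrow> nat" and \<beta> :: "nat \<Rightarrow> real" where "\<And>p. 1 \<le> M p" "\<And>p. 0 < \<beta> p"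
    "filterlim M at_top sequentially" "filterlim \<beta> at_top sequentially" "\<And>p. \<beta> p * e (M p) \<le> 1"
proof -
  have "\<exists>M. M \<ge> Suc p \<and> e M < 1 / real (Suc p)" for p
  proof -
    have "\<forall>\<^sub>F M in sequentially. e M < 1 / real (Suc p)"
      using order_tendstoD(2)[OF assms, of "1 / real (Suc p)"] by simp
    then obtain N where "\<And>M. M \<ge> N \<Longrightarrow> e M < 1 / real (Suc p)"
      by (auto simp: eventually_sequentially)
    then show ?thesis
      by (intro exI[of _ "max N (Suc p)"]) auto
  qed
  then obtain M where M: "\<And>p. M p \<ge> Suc p" "\<And>p. e (M p) < 1 / real (Suc p)"
    by metis
  show thesis
  proof (rule that[of M "\<lambda>p. real (Suc p)"])
    show "1 \<le> M p" for p using M(1)[of p] by simp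
    show "filterlim M at_top sequentially"
      by (rule filterlim_at_top_mono[OF filterlim_Suc]) (use M(1) in auto)
    show "filterlim (\<lambda>p. real (Suc p)) at_top sequentially"
      by (rule filterlim_compose[OF filterlim_real_sequentially filterlim_Suc])
    show "real (Suc p) * e (M p) \<le> 1" for p
      using M(2)[of p] by (simp add: field_simps)
  qed simp
qed

theorem theorem3p4:
  fixes \<Omega> :: "'a::euclidean_space set"
    and K\<^sub>U :: "('u::banach \<Rightarrow>\<^sub>L real) \<Rightarrow> 'u" and K\<^sub>V :: "('v::banach \<Rightarrow>\<^sub>L real) \<Rightarrow> 'v"
    and \<iota>\<^sub>1 :: "'u \<Rightarrow> 'h1::banach" and \<iota>\<^sub>2 :: "'v \<Rightarrow> 'h2::banach"
    and E\<^sub>1 :: "'h1 \<Rightarrow> 'a \<Rightarrow> real" and E\<^sub>2 :: "'h2 \<Rightarrow> 'a \<Rightarrow> real"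
    and \<P> :: "'u \<Rightarrow> 'v \<Rightarrow> real \<Rightarrow> 'a \<Rightarrow> 'p::euclidean_space"
    and \<B> :: "'u \<Rightarrow> 'v \<Rightarrow> 'a \<Rightarrow> 'b::euclidean_space"
    and L :: "nat \<Rightarrow> 'u \<Rightarrow> 'a \<Rightarrow> real" and J :: "nat \<Rightarrow> 'v \<Rightarrow> 'a \<Rightarrow> real"
    and P :: "(nat \<Rightarrow> real) \<times> (nat \<Rightarrow> real) \<times> real \<Rightarrow> 'p"
    and B :: "(nat \<Rightarrow> real) \<times> (nat \<Rightarrow> real) \<Rightarrow> 'b"
    and Q\<^sub>b Q D\<^sub>b D t\<^sub>1 t\<^sub>1' t\<^sub>2 t\<^sub>2' :: nat
    and M\<^sub>\<Omega> :: "nat \<Rightarrow> nat" and x :: "nat \<Rightarrow> nat \<Rightarrow> 'a"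
    and u\<^sub>s :: 'u and m\<^sub>s :: 'v and H\<^sub>s :: real
    and u\<^sub>d :: "nat \<Rightarrow> real \<Rightarrow> 'u" and m\<^sub>d :: "nat \<Rightarrow> real \<Rightarrow> 'v" and H\<^sub>d :: "nat \<Rightarrow> real \<Rightarrow> real"
  assumes norm_U: "quadratic_norm K\<^sub>U" and norm_V: "quadratic_norm K\<^sub>V"
    and structural: "structural_assumption \<Omega> \<P> \<B> Q\<^sub>b Q L D\<^sub>b D J P B"
    and solution: "mfg_solution \<Omega> (E\<^sub>1 \<circ> \<iota>\<^sub>1) (E\<^sub>2 \<circ> \<iota>\<^sub>2) \<P> \<B> (u\<^sub>s, m\<^sub>s, H\<^sub>s)"
    and uniqueness: "\<And>u m H. mfg_solution \<Omega> (E\<^sub>1 \<circ> \<iota>\<^sub>1) (E\<^sub>2 \<circ> \<iota>\<^sub>2) \<P> \<B> (u, m, H) \<Longrightarrow>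
                       (u, m, H) = (u\<^sub>s, m\<^sub>s, H\<^sub>s)"
    and embed_U: "compact_embedding \<iota>\<^sub>1" and embed_H1: "compact_embedding_C t\<^sub>1 t\<^sub>1' \<Omega> E\<^sub>1"
    and embed_V: "compact_embedding \<iota>\<^sub>2" and embed_H2: "compact_embedding_C t\<^sub>2 t\<^sub>2' \<Omega> E\<^sub>2"
    and large_1: "sufficiently_large t\<^sub>1 t\<^sub>1' \<Omega> (E\<^sub>1 \<circ> \<iota>\<^sub>1) Q\<^sub>b Q L"
    and large_2: "sufficiently_large t\<^sub>2 t\<^sub>2' \<Omega> (E\<^sub>2 \<circ> \<iota>\<^sub>2) D\<^sub>b D J"
    and samples: "sample_points \<Omega> M\<^sub>\<Omega> x"
    and quadrature_U: "\<And>u. consistent_quadrature \<Omega> M\<^sub>\<Omega> x ((E\<^sub>1 \<circ> \<iota>\<^sub>1) u)"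
    and quadrature_V: "\<And>m. consistent_quadrature \<Omega> M\<^sub>\<Omega> x ((E\<^sub>2 \<circ> \<iota>\<^sub>2) m)"
    and minimizer: "\<And>M \<beta>. 1 \<le> M \<Longrightarrow> 0 < \<beta> \<Longrightarrow>
          is_arg_min (penalized_objective (E\<^sub>1 \<circ> \<iota>\<^sub>1) (E\<^sub>2 \<circ> \<iota>\<^sub>2) M\<^sub>\<Omega> x M \<beta>) (feasible \<P> \<B> M\<^sub>\<Omega> x M)
            (u\<^sub>d M \<beta>, m\<^sub>d M \<beta>, H\<^sub>d M \<beta>)"
  shows "\<exists>(M :: nat \<Rightarrow> nat) (\<beta> :: nat \<Rightarrow> real).
           (\<forall>p. 1 \<le> M p \<and> 0 < \<beta> p) \<and>
           filterlim M at_top sequentially \<and> filterlim \<beta> at_top sequentially \<and>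
           (\<forall>y\<in>\<Omega>. (\<lambda>p. E\<^sub>1 (\<iota>\<^sub>1 (u\<^sub>d (M p) (\<beta> p))) y) \<longlonglongrightarrow> E\<^sub>1 (\<iota>\<^sub>1 u\<^sub>s) y) \<and>
           (\<forall>y\<in>\<Omega>. (\<lambda>p. E\<^sub>2 (\<iota>\<^sub>2 (m\<^sub>d (M p) (\<beta> p))) y) \<longlonglongrightarrow> E\<^sub>2 (\<iota>\<^sub>2 m\<^sub>s) y) \<and>
           (\<lambda>p. \<iota>\<^sub>1 (u\<^sub>d (M p) (\<beta> p))) \<longlonglongrightarrow> \<iota>\<^sub>1 u\<^sub>s \<and>
           (\<lambda>p. \<iota>\<^sub>2 (m\<^sub>d (M p) (\<beta> p))) \<longlonglongrightarrow> \<iota>\<^sub>2 m\<^sub>s \<and>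
           (\<lambda>p. H\<^sub>d (M p) (\<beta> p)) \<longlonglongrightarrow> H\<^sub>s"
proof -
  have \<iota>: "bounded_linear \<iota>\<^sub>1" "bounded_linear \<iota>\<^sub>2"
    using embed_U embed_V by (auto simp: compact_embedding_def)
  have pts: "1 \<le> M\<^sub>\<Omega> M" "x M ` {1..M\<^sub>\<Omega> M} \<subseteq> interior \<Omega>" "x M ` {M\<^sub>\<Omega> M+1..M} \<subseteq> frontier \<Omega>"
    if "1 \<le> M" for M
    using samples that by (auto simp: sample_points_def)
  have ne: "interior \<Omega> \<noteq> {}"
    using pts(1,2)[of 1] by auto
  have feasible_s: "feasible \<P> \<B> M\<^sub>\<Omega> x M (u\<^sub>s, m\<^sub>s, H\<^sub>s)" if "1 \<le> M" for M
    using solution pts(2,3)[OF that] by (auto simp: feasible_def mfg_solution_def image_subset_iff)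
  define a where "a M = sample_mean M\<^sub>\<Omega> x M ((E\<^sub>1 \<circ> \<iota>\<^sub>1) u\<^sub>s)" for M
  define b where "b M = sample_mean M\<^sub>\<Omega> x M ((E\<^sub>2 \<circ> \<iota>\<^sub>2) m\<^sub>s)" for M
  have "a \<longlonglongrightarrow> 0" "b \<longlonglongrightarrow> 1"
    using solution quadrature_U[of u\<^sub>s] quadrature_V[of m\<^sub>s]
    by (auto simp: a_def[abs_def] b_def[abs_def] mfg_solution_def consistent_quadrature_def has_integral_iff)
  then have "(\<lambda>M. \<bar>a M\<bar>\<^sup>2 + \<bar>b M - 1\<bar>\<^sup>2) \<longlonglongrightarrow> \<bar>0\<bar>\<^sup>2 + \<bar>1 - 1\<bar>\<^sup>2"
    by (intro tendsto_intros)
  then have "(\<lambda>M. \<bar>a M\<bar>\<^sup>2 + \<bar>b M - 1\<bar>\<^sup>2) \<longlonglongrightarrow> 0"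
    by simp
  then obtain M \<beta> where M: "\<And>p. 1 \<le> M p" and \<beta>: "\<And>p. 0 < \<beta> p"
    and M_top: "filterlim M at_top sequentially" and \<beta>_top: "filterlim \<beta> at_top sequentially"
    and small: "\<And>p. \<beta> p * (\<bar>a (M p)\<bar>\<^sup>2 + \<bar>b (M p) - 1\<bar>\<^sup>2) \<le> 1"
    by (rule diagonal_penalty_choice) blast

  define u where "u p = u\<^sub>d (M p) (\<beta> p)" for p
  define m where "m p = m\<^sub>d (M p) (\<beta> p)" for p
  define H where "H p = H\<^sub>d (M p) (\<beta> p)" for p
  define \<alpha> where "\<alpha> p = sample_mean M\<^sub>\<Omega> x (M p) (E\<^sub>1 (\<iota>\<^sub>1 (u p)))" for p
  define \<gamma> where "\<gamma> p = sample_mean M\<^sub>\<Omega> x (M p) (E\<^sub>2 (\<iota>\<^sub>2 (m p))) - 1" for p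
  define C where "C = (norm u\<^sub>s)\<^sup>2 + (norm m\<^sub>s)\<^sup>2 + \<bar>H\<^sub>s\<bar>\<^sup>2 + 1"
  have feasible_d: "feasible \<P> \<B> M\<^sub>\<Omega> x (M p) (u p, m p, H p)" for p
    using minimizer[OF M \<beta>] by (simp add: is_arg_min_def u_def m_def H_def)
  have total: "(norm (u p))\<^sup>2 + (norm (m p))\<^sup>2 + \<bar>H p\<bar>\<^sup>2 + \<beta> p * \<bar>\<alpha> p\<bar>\<^sup>2 + \<beta> p * \<bar>\<gamma> p\<bar>\<^sup>2 \<le> C" for p
  proof -
    have "penalized_objective (E\<^sub>1 \<circ> \<iota>\<^sub>1) (E\<^sub>2 \<circ> \<iota>\<^sub>2) M\<^sub>\<Omega> x (M p) (\<beta> p) (u p, m p, H p) \<le>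
        penalized_objective (E\<^sub>1 \<circ> \<iota>\<^sub>1) (E\<^sub>2 \<circ> \<iota>\<^sub>2) M\<^sub>\<Omega> x (M p) (\<beta> p) (u\<^sub>s, m\<^sub>s, H\<^sub>s)"
      using minimizer[OF M \<beta>, of p p] feasible_s[OF M, of p]
      unfolding is_arg_min_def u_def m_def H_def by (meson not_less)
    also have "\<dots> \<le> C"
      using small[of p] by (simp add: penalized_objective_def C_def a_def b_def algebra_simps)
    finally show ?thesis
      by (simp add: penalized_objective_def \<alpha>_def \<gamma>_def)
  qed
  have nonneg: "0 \<le> \<beta> p * \<bar>\<alpha> p\<bar>\<^sup>2" "0 \<le> \<beta> p * \<bar>\<gamma> p\<bar>\<^sup>2" for p
    using \<beta>[of p] by simp_all
  have bounds: "(norm (u p))\<^sup>2 \<le> C" "(norm (m p))\<^sup>2 \<le> C" "\<bar>H p\<bar>\<^sup>2 \<le> C"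
      "\<beta> p * \<bar>\<alpha> p\<bar>\<^sup>2 \<le> C" "\<beta> p * \<bar>\<gamma> p\<bar>\<^sup>2 \<le> C" for p
    using total[of p] nonneg[of p] zero_le_power2[of "norm (u p)"] zero_le_power2[of "norm (m p)"]
      zero_le_power2[of "\<bar>H p\<bar>"] by linarith+
  have \<alpha>_lim: "\<alpha> \<longlonglongrightarrow> 0" and \<gamma>_lim: "\<gamma> \<longlonglongrightarrow> 0"
    by (rule bounded_penalty_imp_tendsto_zero[OF \<beta> \<beta>_top bounds(4)],
        rule bounded_penalty_imp_tendsto_zero[OF \<beta> \<beta>_top bounds(5)])
  have bdd: "bounded (range u)" "bounded (range m)" "bounded (range H)"
    using bounds(1,2,3) by (auto simp: bounded_iff intro!: exI[of _ "sqrt C"] real_le_rsqrt)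

  obtain r\<^sub>1 u' where r1: "strict_mono r\<^sub>1" "(\<lambda>n. \<iota>\<^sub>1 (u (r\<^sub>1 n))) \<longlonglongrightarrow> \<iota>\<^sub>1 u'"
    using compact_embedding_convergent_subsequence[OF norm_U embed_U bdd(1)] .
  have "bounded (range (m \<circ> r\<^sub>1))"
    using bdd(2) by (rule bounded_subset) auto
  then obtain r\<^sub>2 m' where r2: "strict_mono r\<^sub>2" "(\<lambda>n. \<iota>\<^sub>2 ((m \<circ> r\<^sub>1) (r\<^sub>2 n))) \<longlonglongrightarrow> \<iota>\<^sub>2 m'"
    by (rule compact_embedding_convergent_subsequence[OF norm_V embed_V]) blast
  have "bounded (range (H \<circ> r\<^sub>1 \<circ> r\<^sub>2))"
    using bdd(3) by (rule bounded_subset) auto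
  then obtain H' r\<^sub>3 where r3: "strict_mono r\<^sub>3" "((H \<circ> r\<^sub>1 \<circ> r\<^sub>2) \<circ> r\<^sub>3) \<longlonglongrightarrow> H'"
    using bounded_imp_convergent_subsequence by blast
  define r where "r = r\<^sub>1 \<circ> r\<^sub>2 \<circ> r\<^sub>3"
  have r: "strict_mono r"
    unfolding r_def using r1(1) r2(1) r3(1) by (intro strict_mono_o)
  have r_top: "filterlim r at_top sequentially"
    using r by (rule filterlim_subseq)
  have conv: "(\<lambda>n. \<iota>\<^sub>1 (u (r n))) \<longlonglongrightarrow> \<iota>\<^sub>1 u'" "(\<lambda>n. \<iota>\<^sub>2 (m (r n))) \<longlonglongrightarrow> \<iota>\<^sub>2 m'"
      "(\<lambda>n. H (r n)) \<longlonglongrightarrow> H'"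
    using LIMSEQ_subseq_LIMSEQ[OF r1(2) strict_mono_o[OF r2(1) r3(1)]]
      LIMSEQ_subseq_LIMSEQ[OF r2(2) r3(1)] r3(2) by (simp_all add: r_def o_def)
  have Mr_top: "filterlim (\<lambda>n. M (r n)) at_top sequentially"
    by (rule filterlim_compose[OF M_top r_top])

  have families: "operator_family \<Omega> Q\<^sub>b Q L" "operator_family \<Omega> D\<^sub>b D J"
    and P_cont: "continuous_on (({Q\<^sub>b+1..Q} \<rightarrow>\<^sub>E UNIV) \<times> ({D\<^sub>b+1..D} \<rightarrow>\<^sub>E UNIV) \<times> UNIV) P"
    and B_cont: "continuous_on (({1..Q\<^sub>b} \<rightarrow>\<^sub>E UNIV) \<times> ({1..D\<^sub>b} \<rightarrow>\<^sub>E UNIV)) B"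
    and P_eq: "\<And>u m H y. y \<in> interior \<Omega> \<Longrightarrow>
        \<P> u m H y = P (\<lambda>q\<in>{Q\<^sub>b+1..Q}. L q u y, \<lambda>j\<in>{D\<^sub>b+1..D}. J j m y, H)"
    and B_eq: "\<And>u m y. y \<in> frontier \<Omega> \<Longrightarrow>
        \<B> u m y = B (\<lambda>q\<in>{1..Q\<^sub>b}. L q u y, \<lambda>j\<in>{1..D\<^sub>b}. J j m y)"
    using structural by (auto simp: structural_assumption_def)
  have L_ops: "\<And>q. q \<in> {Q\<^sub>b+1..Q} \<Longrightarrow> bounded_operator_C (interior \<Omega>) (L q)"
      "\<And>q. q \<in> {1..Q\<^sub>b} \<Longrightarrow> bounded_operator_C (frontier \<Omega>) (L q)"
    and J_ops: "\<And>j. j \<in> {D\<^sub>b+1..D} \<Longrightarrow> bounded_operator_C (interior \<Omega>) (J j)"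
      "\<And>j. j \<in> {1..D\<^sub>b} \<Longrightarrow> bounded_operator_C (frontier \<Omega>) (J j)"
    using families by (auto simp: operator_family_def)
  have L_bounds:
      "\<And>q. q \<in> {Q\<^sub>b+1..Q} \<Longrightarrow> \<exists>c. \<forall>u. \<forall>y\<in>interior \<Omega>. \<bar>L q u y\<bar> \<le> c * norm (\<iota>\<^sub>1 u)"
      "\<And>q. q \<in> {1..Q\<^sub>b} \<Longrightarrow> \<exists>c. \<forall>u. \<forall>y\<in>frontier \<Omega>. \<bar>L q u y\<bar> \<le> c * norm (\<iota>\<^sub>1 u)"
    using large_1 unfolding sufficiently_large_def
    by (intro operator_bound_intermediate_norm[OF embed_H1 ne], blast)+
  have J_bounds:
      "\<And>j. j \<in> {D\<^sub>b+1..D} \<Longrightarrow> \<exists>c. \<forall>m. \<forall>y\<in>interior \<Omega>. \<bar>J j m y\<bar> \<le> c * norm (\<iota>\<^sub>2 m)"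
      "\<And>j. j \<in> {1..D\<^sub>b} \<Longrightarrow> \<exists>c. \<forall>m. \<forall>y\<in>frontier \<Omega>. \<bar>J j m y\<bar> \<le> c * norm (\<iota>\<^sub>2 m)"
    using large_2 unfolding sufficiently_large_def
    by (intro operator_bound_intermediate_norm[OF embed_H2 ne], blast)+

  have "mfg_solution \<Omega> (E\<^sub>1 \<circ> \<iota>\<^sub>1) (E\<^sub>2 \<circ> \<iota>\<^sub>2) \<P> \<B> (u', m', H')"
    unfolding mfg_solution_def prod.case
  proof (intro conjI ballI)
    fix y assume y: "y \<in> interior \<Omega>"
    have fill: "(\<lambda>n. fill_distance (interior \<Omega>) (x (M (r n)) ` {1..M\<^sub>\<Omega> (M (r n))})) \<longlonglongrightarrow> 0"
      using samples
      by (intro filterlim_compose[OF _ Mr_top]) (simp add: sample_points_def)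
    have zero: "P (\<lambda>q\<in>{Q\<^sub>b+1..Q}. L q (u (r n)) z, \<lambda>j\<in>{D\<^sub>b+1..D}. J j (m (r n)) z, H (r n)) = 0"
      if "z \<in> x (M (r n)) ` {1..M\<^sub>\<Omega> (M (r n))}" for n z
    proof -
      have "\<P> (u (r n)) (m (r n)) (H (r n)) z = 0"
        using that feasible_d[of "r n"] by (auto simp: feasible_def)
      then show ?thesis
        using P_eq[of z] subsetD[OF pts(2)[OF M] that] by simp
    qed
    show "\<P> u' m' H' y = 0"
      unfolding P_eq[OF y]
      by (rule constraint_passes_to_limit[OF \<iota> L_ops(1) L_bounds(1) J_ops(1) J_bounds(1) P_cont
            conv fill pts(2)[OF M] zero y])
  next
    fix y assume y: "y \<in> frontier \<Omega>"
    have fill: "(\<lambda>n. fill_distance (frontier \<Omega>) (x (M (r n)) ` {M\<^sub>\<Omega> (M (r n))+1..M (r n)})) \<longlonglongrightarrow> 0"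
      using samples
      by (intro filterlim_compose[OF _ Mr_top]) (simp add: sample_points_def)
    \<comment> \<open>\<open>\<B>\<close> does not depend on \<open>H\<close>, so \<open>B\<close> is padded by a dummy argument.\<close>
    define G where "G = (\<lambda>(a, b, h :: real). B (a, b))"
    have "continuous_on (({1..Q\<^sub>b} \<rightarrow>\<^sub>E UNIV) \<times> ({1..D\<^sub>b} \<rightarrow>\<^sub>E UNIV) \<times> UNIV)
        (\<lambda>w. B (fst w, fst (snd w)))"
      by (rule continuous_on_compose2[OF B_cont])
        (auto intro!: continuous_on_Pair continuous_on_fst continuous_on_snd continuous_on_id)
    then have G_cont: "continuous_on (({1..Q\<^sub>b} \<rightarrow>\<^sub>E UNIV) \<times> ({1..D\<^sub>b} \<rightarrow>\<^sub>E UNIV) \<times> UNIV) G"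
      by (simp add: G_def case_prod_unfold)
    have zero: "G (\<lambda>q\<in>{1..Q\<^sub>b}. L q (u (r n)) z, \<lambda>j\<in>{1..D\<^sub>b}. J j (m (r n)) z, H (r n)) = 0"
      if "z \<in> x (M (r n)) ` {M\<^sub>\<Omega> (M (r n))+1..M (r n)}" for n z
    proof -
      have "\<B> (u (r n)) (m (r n)) z = 0"
        using that feasible_d[of "r n"] by (auto simp: feasible_def)
      then show ?thesis
        using B_eq[of z] subsetD[OF pts(3)[OF M] that] by (simp add: G_def)
    qed
    have "G (\<lambda>q\<in>{1..Q\<^sub>b}. L q u' y, \<lambda>j\<in>{1..D\<^sub>b}. J j m' y, H') = 0"
      by (rule constraint_passes_to_limit[OF \<iota> L_ops(2) L_bounds(2) J_ops(2) J_bounds(2) G_cont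
            conv fill pts(3)[OF M] zero y])
    then show "\<B> u' m' y = 0"
      by (simp add: B_eq[OF y] G_def)
  next
    have "(\<lambda>n. sample_mean M\<^sub>\<Omega> x (M (r n)) (E\<^sub>1 (\<iota>\<^sub>1 (u (r n))))) \<longlonglongrightarrow> 0"
      using filterlim_compose[OF \<alpha>_lim r_top] by (simp add: \<alpha>_def)
    from sample_mean_passes_to_limit[OF embed_H1 samples _ M Mr_top conv(1) this]
    show "((E\<^sub>1 \<circ> \<iota>\<^sub>1) u' has_integral 0) \<Omega>"
      using quadrature_U[of u'] by simp
  next
    have "(\<lambda>n. sample_mean M\<^sub>\<Omega> x (M (r n)) (E\<^sub>2 (\<iota>\<^sub>2 (m (r n)))) - 1) \<longlonglongrightarrow> 0"
      using filterlim_compose[OF \<gamma>_lim r_top] by (simp add: \<gamma>_def)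
    then have "(\<lambda>n. sample_mean M\<^sub>\<Omega> x (M (r n)) (E\<^sub>2 (\<iota>\<^sub>2 (m (r n))))) \<longlonglongrightarrow> 1"
      by (rule LIM_zero_cancel)
    from sample_mean_passes_to_limit[OF embed_H2 samples _ M Mr_top conv(2) this]
    show "((E\<^sub>2 \<circ> \<iota>\<^sub>2) m' has_integral 1) \<Omega>"
      using quadrature_V[of m'] by simp
  qed
  from uniqueness[OF this] have limit: "u' = u\<^sub>s" "m' = m\<^sub>s" "H' = H\<^sub>s"
    by simp_all

  \<comment> \<open>Point evaluation at \<open>y\<close> is continuous on the intermediate spaces.\<close>
  have pointwise: "(\<lambda>n. E\<^sub>1 (\<iota>\<^sub>1 (u (r n))) y) \<longlonglongrightarrow> E\<^sub>1 (\<iota>\<^sub>1 u\<^sub>s) y"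
      "(\<lambda>n. E\<^sub>2 (\<iota>\<^sub>2 (m (r n))) y) \<longlonglongrightarrow> E\<^sub>2 (\<iota>\<^sub>2 m\<^sub>s) y" if "y \<in> \<Omega>" for y
  proof -
    have y: "y \<in> closure \<Omega>"
      using that closure_subset by blast
    show "(\<lambda>n. E\<^sub>1 (\<iota>\<^sub>1 (u (r n))) y) \<longlonglongrightarrow> E\<^sub>1 (\<iota>\<^sub>1 u\<^sub>s) y"
      using bounded_linear.tendsto[OF compact_embedding_C_evaluation[OF embed_H1 ne y] conv(1)]
      by (simp add: limit)
    show "(\<lambda>n. E\<^sub>2 (\<iota>\<^sub>2 (m (r n))) y) \<longlonglongrightarrow> E\<^sub>2 (\<iota>\<^sub>2 m\<^sub>s) y"
      using bounded_linear.tendsto[OF compact_embedding_C_evaluation[OF embed_H2 ne y] conv(2)]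
      by (simp add: limit)
  qed
  show ?thesis
  proof (intro exI conjI)
    show "\<forall>p. 1 \<le> M (r p) \<and> 0 < \<beta> (r p)"
      using M \<beta> by simp
    show "filterlim (\<lambda>p. M (r p)) at_top sequentially" "filterlim (\<lambda>p. \<beta> (r p)) at_top sequentially"
      by (rule Mr_top, rule filterlim_compose[OF \<beta>_top r_top])
  qed (use conv pointwise in \<open>auto simp: limit u_def m_def H_def\<close>)
qed

end
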